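(* Let $k$ be a field of characteristic zero, let $m\ge 3$, and let $\mathbf X=(x_{kl})$, $1\le k\le 2$, $1\le l\le m$, be a $2\times m$ generic matrix over $k$ (its entries are independent indeterminates). Let $R=k[x_{kl}]$ be the polynomial ring in the entries and $A=k[\mathbf f]\subset R$, where $\mathbf f$ is the set of the $2\times 2$ minors of $\mathbf X$. Then $\mathbf f$ is polarizable.
   Context: Let $\mathbf f=f_1,\ldots,f_N$ be forms in a polynomial ring $R=k[y_1,\ldots,y_n]$ over $k$, and let $P$ be the kernel of $k[T_1,\ldots,T_N]\to R$, $T_j\mapsto f_j$. For $f\in R$ put $df=\sum_{i=1}^n\frac{\partial f}{\partial y_i}dy_i$ in the free $R$-module $\sum_{i=1}^n R\,dy_i$. The differential syzygy module $\mathfrak{Z}$ is the kernel of the $R$-linear map $\sum_{j=1}^N R\,dT_j\to\sum_{i=1}^n R\,dy_i$, $dT_j\mapsto df_j$, where $\sum_j R\,dT_j$ is free with basis $dT_1,\ldots,dT_N$. The polar syzygy module $\mathfrak{D}\subset\mathfrak{Z}$ is the $R$-submodule generated by the vectors $\sum_{j=1}^N\frac{\partial F}{\partial T_j}(\mathbf f)\,dT_j$, $F\in P$. $\mathbf f$ is polarizable if $\mathfrak{D}=\mathfrak{Z}$. *)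

theory Defs
  imports Complex_Main "HOL-Library.Poly_Mapping"
begin

text \<open>
  A monomial is a finitely supported exponent function, a polynomial a finitely supported
  coefficient function on monomials; the ring operations are those of the instance of
  \<^class>\<open>comm_ring_1\<close> for \<^type>\<open>poly_mapping\<close>.
\<close>

type_synonym ('v, 'a) mpoly = "('v \<Rightarrow>\<^sub>0 nat) \<Rightarrow>\<^sub>0 'a"

text \<open>The carrier of the polynomial ring \<open>k[y\<^sub>v | v \<in> V]\<close>.\<close>

definition polys_in :: "'v set \<Rightarrow> ('v, 'a::zero) mpoly set" where
  "polys_in V = {p. \<forall>m \<in> Poly_Mapping.keys p. Poly_Mapping.keys m \<subseteq> V}"

definition const :: "'a::zero \<Rightarrow> ('v, 'a) mpoly" where
  "const c = Poly_Mapping.single 0 c"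

definition var :: "'v \<Rightarrow> ('v, 'a::zero_neq_one) mpoly" where
  "var v = Poly_Mapping.single (Poly_Mapping.single v 1) 1"

text \<open>
  Subtraction of exponents is truncated, but when \<open>v\<close> does not occur in \<open>m\<close> the coefficient
  of the corresponding summand is \<open>0\<close>.
\<close>

definition partial :: "'v \<Rightarrow> ('v, 'a::comm_semiring_1) mpoly \<Rightarrow> ('v, 'a) mpoly" where
  "partial v p = (\<Sum>m \<in> Poly_Mapping.keys p.
     Poly_Mapping.single (m - Poly_Mapping.single v 1)
       (of_nat (Poly_Mapping.lookup m v) * Poly_Mapping.lookup p m))"

text \<open>\<open>subst f F\<close> is \<open>F(f)\<close>, the image of \<open>F\<close> under the \<open>k\<close>-algebra map with \<open>T\<^sub>j \<mapsto> f j\<close>.\<close>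

definition subst :: "('j \<Rightarrow> ('v, 'a::comm_semiring_1) mpoly) \<Rightarrow> ('j, 'a) mpoly \<Rightarrow> ('v, 'a) mpoly"
  where
  "subst f F = (\<Sum>m \<in> Poly_Mapping.keys F.
     const (Poly_Mapping.lookup F m) *
     (\<Prod>j \<in> Poly_Mapping.keys m. f j ^ Poly_Mapping.lookup m j))"

text \<open>
  In what follows \<open>V\<close> is the finite index set of the variables of \<open>R\<close>, \<open>J\<close> the finite index set
  of the family \<open>f\<close> (only its values on \<open>J\<close> matter) and of the variables \<open>T\<^sub>j\<close>.
  An element of a free \<open>R\<close>-module with basis indexed by \<open>I\<close> is given by its coordinate function,
  extended by \<open>0\<close> outside \<open>I\<close>.
\<close>

definition free_module :: "'v set \<Rightarrow> 'i set \<Rightarrow> ('i \<Rightarrow> ('v, 'a::zero) mpoly) set" where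
  "free_module V I = {z. (\<forall>i \<in> I. z i \<in> polys_in V) \<and> (\<forall>i. i \<notin> I \<longrightarrow> z i = 0)}"

definition is_submodule ::
  "'v set \<Rightarrow> 'i set \<Rightarrow> ('i \<Rightarrow> ('v, 'a::comm_semiring_1) mpoly) set \<Rightarrow> bool" where
  "is_submodule V I M \<longleftrightarrow>
     M \<subseteq> free_module V I \<and>
     (\<lambda>_. 0) \<in> M \<and>
     (\<forall>z \<in> M. \<forall>w \<in> M. (\<lambda>i. z i + w i) \<in> M) \<and>
     (\<forall>r \<in> polys_in V. \<forall>z \<in> M. (\<lambda>i. r * z i) \<in> M)"

definition differential ::
  "'v set \<Rightarrow> ('v, 'a::comm_semiring_1) mpoly \<Rightarrow> ('v \<Rightarrow> ('v, 'a) mpoly)" where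
  "differential V p = (\<lambda>v. if v \<in> V then partial v p else 0)"

text \<open>The kernel of \<open>k[T\<^sub>j | j \<in> J] \<rightarrow> R\<close>, \<open>T\<^sub>j \<mapsto> f j\<close>.\<close>

definition relation_ideal ::
  "'j set \<Rightarrow> ('j \<Rightarrow> ('v, 'a::comm_semiring_1) mpoly) \<Rightarrow> ('j, 'a) mpoly set" where
  "relation_ideal J f = {F \<in> polys_in J. subst f F = 0}"

text \<open>The kernel of \<open>\<Sum>\<^sub>j R dT\<^sub>j \<rightarrow> \<Sum>\<^sub>v R dy\<^sub>v\<close>, \<open>dT\<^sub>j \<mapsto> df\<^sub>j\<close>.\<close>

definition differential_syzygies ::
  "'v set \<Rightarrow> 'j set \<Rightarrow> ('j \<Rightarrow> ('v, 'a::comm_semiring_1) mpoly) \<Rightarrow> ('j \<Rightarrow> ('v, 'a) mpoly) set" where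
  "differential_syzygies V J f =
     {z \<in> free_module V J. (\<lambda>v. \<Sum>j\<in>J. z j * differential V (f j) v) = (\<lambda>_. 0)}"

text \<open>
  For \<open>F\<close> in the variables \<open>T\<^sub>j\<close>, \<open>j \<in> J\<close>, the coordinates \<open>\<partial>F/\<partial>T\<^sub>j\<close> with \<open>j \<notin> J\<close> vanish, so the
  generators below do lie in the free module.
\<close>

definition polar_syzygies ::
  "'v set \<Rightarrow> 'j set \<Rightarrow> ('j \<Rightarrow> ('v, 'a::comm_semiring_1) mpoly) \<Rightarrow> ('j \<Rightarrow> ('v, 'a) mpoly) set" where
  "polar_syzygies V J f =
     is_submodule V J hull {(\<lambda>j. subst f (partial j F)) | F. F \<in> relation_ideal J f}"

definition polarizable ::
  "'v set \<Rightarrow> 'j set \<Rightarrow> ('j \<Rightarrow> ('v, 'a::comm_semiring_1) mpoly) \<Rightarrow> bool" where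
  "polarizable V J f \<longleftrightarrow> polar_syzygies V J f = differential_syzygies V J f"

text \<open>The entry of the generic matrix in row \<open>r\<close> and column \<open>l\<close> is the variable indexed by \<open>(r, l)\<close>.\<close>

definition generic_entry :: "nat \<Rightarrow> nat \<Rightarrow> (nat \<times> nat, 'a::zero_neq_one) mpoly" where
  "generic_entry r l = var (r, l)"

definition entry_indices :: "nat \<Rightarrow> (nat \<times> nat) set" where
  "entry_indices m = {1..2} \<times> {1..m}"

text \<open>A pair \<open>(i, j)\<close> with \<open>i < j\<close> stands for the minor on columns \<open>i\<close> and \<open>j\<close>.\<close>

definition minor_indices :: "nat \<Rightarrow> (nat \<times> nat) set" where
  "minor_indices m = {(i, j). 1 \<le> i \<and> i < j \<and> j \<le> m}"

definition minor2 :: "nat \<times> nat \<Rightarrow> (nat \<times> nat, 'a::comm_ring_1) mpoly" where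
  "minor2 = (\<lambda>(i, j). generic_entry 1 i * generic_entry 2 j - generic_entry 1 j * generic_entry 2 i)"

end

theory Submission
  imports Defs
begin

text \<open>
  Write \<open>x\<close> and \<open>y\<close> for the rows of the generic matrix.  A syzygy \<open>z\<close> of the differentials of the minors,
  extended to a skew-symmetric matrix \<open>Z\<close>, is the same as an element \<open>\<omega> = \<Sum> Z\<^sub>i\<^sub>j e\<^sub>i \<and> e\<^sub>j\<close> (over \<open>i < j\<close>)
  of \<open>\<Lambda>\<^sup>2R\<^sup>m\<close> with \<open>\<iota>\<^sub>x\<omega> = \<iota>\<^sub>y\<omega> = 0\<close>, because the derivatives of the minor on columns \<open>i, j\<close> are the entries of
  these columns up to sign (\<open>differential_syzygy_null_matrix\<close>).  On the other hand the gradient of the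
  Pluecker relation on columns \<open>a, b, c, d\<close> is \<open>\<iota>\<^sub>y\<iota>\<^sub>x(e\<^sub>a \<and> e\<^sub>b \<and> e\<^sub>c \<and> e\<^sub>d)\<close> up to sign.  So it suffices that
  every \<open>\<omega>\<close> killed by both contractions lies in \<open>\<iota>\<^sub>y\<iota>\<^sub>x(\<Lambda>\<^sup>4R\<^sup>m)\<close>.

  In characteristic zero this has an explicit reason.  Put \<open>d\<^sub>x = \<Sum>\<^sub>k e\<^sub>k \<and> \<partial>/\<partial>x\<^sub>k\<close> and \<open>d\<^sub>y = \<Sum>\<^sub>k e\<^sub>k \<and> \<partial>/\<partial>y\<^sub>k\<close>.
  The anticommutators of \<open>\<iota>\<^sub>x, \<iota>\<^sub>y\<close> with \<open>d\<^sub>x, d\<^sub>y\<close> are, up to the form degree, the polarization operators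
  \<open>x\<partial>/\<partial>x\<close>, \<open>x\<partial>/\<partial>y\<close>, \<open>y\<partial>/\<partial>x\<close>, \<open>y\<partial>/\<partial>y\<close>, and for \<open>\<omega>\<close> of degree \<open>a\<close> in \<open>x\<close> and \<open>b\<close> in \<open>y\<close> they give
  \<open>\<iota>\<^sub>y\<iota>\<^sub>xd\<^sub>xd\<^sub>y\<omega> = (a + 3)(b + 2)\<omega> - y\<partial>/\<partial>x (x\<partial>/\<partial>y \<omega>)\<close> (\<open>homotopy_formula\<close>).  Now \<open>x\<partial>/\<partial>y \<omega>\<close> is again
  killed by both contractions and has degree \<open>b - 1\<close> in \<open>y\<close>, so by induction on \<open>b\<close> it lies in the polar
  syzygy module.  That module is stable under \<open>y\<partial>/\<partial>x\<close>, a derivation which kills the minors and hence all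
  coordinates of the generators (\<open>derivation_preserves_polar_syzygies\<close>).  Dividing by \<open>(a + 3)(b + 2)\<close>
  gives the claim for bihomogeneous \<open>\<omega>\<close>, and the general case follows by taking components.
\<close>


section \<open>Polynomials as finitely supported functions\<close>

lemma sum_single_lookup:
  "(\<Sum>m\<in>Poly_Mapping.keys p. Poly_Mapping.single m (Poly_Mapping.lookup p m)) = p"
  by (rule poly_mapping_eqI) (auto simp: lookup_sum lookup_single when_def in_keys_iff)

text \<open>
  An additive map on polynomials is determined by its values on the terms \<open>c y\<^sup>m\<close>; identities that are
  linear or bilinear in polynomials are thereby checked on terms.
\<close>

lemma additive_eqI:
  fixes g h :: "('v, 'a::comm_ring_1) mpoly \<Rightarrow> 'b::comm_monoid_add"
  assumes g: "\<And>p q. g (p + q) = g p + g q" and h: "\<And>p q. h (p + q) = h p + h q"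
    and single: "\<And>m c. g (Poly_Mapping.single m c) = h (Poly_Mapping.single m c)"
  shows "g p = h p"
proof -
  have zero: "g 0 = h 0"
    using single[of 0 0] by simp
  have "g (\<Sum>m\<in>S. Poly_Mapping.single m (c m)) = h (\<Sum>m\<in>S. Poly_Mapping.single m (c m))"
    for S and c :: "_ \<Rightarrow> 'a"
    by (induction S rule: infinite_finite_induct) (auto simp: zero g h single)
  from this[of "Poly_Mapping.lookup p" "Poly_Mapping.keys p"] show ?thesis
    by (simp add: sum_single_lookup)
qed

lemma additive_sum:
  fixes g :: "'a::cancel_comm_monoid_add \<Rightarrow> 'b::cancel_comm_monoid_add"
  assumes "\<And>p q. g (p + q) = g p + g q"
  shows "g (\<Sum>i\<in>S. h i) = (\<Sum>i\<in>S. g (h i))"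
proof -
  have "g 0 = 0"
    using assms[of 0 0] by simp
  then show ?thesis
    by (induction S rule: infinite_finite_induct) (auto simp: assms)
qed

lemma polys_in_zero [simp]: "0 \<in> polys_in V"
  by (simp add: polys_in_def)

lemma polys_in_const [simp]: "const c \<in> polys_in V"
  by (auto simp: polys_in_def const_def)

lemma polys_in_var: "v \<in> V \<Longrightarrow> var v \<in> polys_in V"
  by (auto simp: polys_in_def var_def)

lemma polys_in_add: "p \<in> polys_in V \<Longrightarrow> q \<in> polys_in V \<Longrightarrow> p + q \<in> polys_in V"
  using keys_add[of p q] by (auto simp: polys_in_def)

lemma polys_in_uminus:
  fixes p :: "('v, 'a::comm_ring_1) mpoly"
  shows "p \<in> polys_in V \<Longrightarrow> - p \<in> polys_in V"
  by (auto simp: polys_in_def in_keys_iff)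

lemma polys_in_diff:
  fixes p :: "('v, 'a::comm_ring_1) mpoly"
  shows "p \<in> polys_in V \<Longrightarrow> q \<in> polys_in V \<Longrightarrow> p - q \<in> polys_in V"
  using polys_in_add[of p V "- q"] polys_in_uminus[of q V] by simp

lemma polys_in_mult:
  assumes "p \<in> polys_in V" "q \<in> polys_in V"
  shows "p * q \<in> polys_in V"
  unfolding polys_in_def
proof (intro CollectI ballI)
  fix m assume "m \<in> Poly_Mapping.keys (p * q)"
  with keys_mult[of p q] obtain a b
    where "m = a + b" "a \<in> Poly_Mapping.keys p" "b \<in> Poly_Mapping.keys q"
    by blast
  then have "Poly_Mapping.keys m \<subseteq> Poly_Mapping.keys a \<union> Poly_Mapping.keys b"
    "Poly_Mapping.keys a \<subseteq> V" "Poly_Mapping.keys b \<subseteq> V"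
    using assms keys_add[of a b] by (simp_all add: polys_in_def)
  then show "Poly_Mapping.keys m \<subseteq> V" by blast
qed

lemma polys_in_sum: "(\<And>i. i \<in> S \<Longrightarrow> g i \<in> polys_in V) \<Longrightarrow> (\<Sum>i\<in>S. g i) \<in> polys_in V"
  by (induction S rule: infinite_finite_induct) (auto intro: polys_in_add)

lemma const_add: "const (a + b) = const a + const b"
  by (simp add: const_def single_add)

lemma const_mult: "const (a * b) = const a * const b"
  by (simp add: const_def mult_single)

lemma const_one: "const 1 = 1"
  by (simp add: const_def)

lemma const_of_nat: "const (of_nat n) = of_nat n"
  by (simp add: const_def)

lemma var_power: "var v ^ n = Poly_Mapping.single (Poly_Mapping.single v n) 1"
  by (induction n) (simp_all add: var_def mult_single single_add[symmetric])

lemma prod_single: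
  "(\<Prod>i\<in>S. Poly_Mapping.single (g i) 1) =
    (Poly_Mapping.single (\<Sum>i\<in>S. g i) 1 :: ('v, 'a::comm_semiring_1) mpoly)"
  by (induction S rule: infinite_finite_induct) (auto simp: mult_single)

lemma single_eq_const_mult_prod_var:
  "Poly_Mapping.single m c =
    const c * (\<Prod>v\<in>Poly_Mapping.keys m. var v ^ Poly_Mapping.lookup m v)"
  by (simp add: var_power prod_single const_def mult_single sum_single_lookup)

text \<open>
  \<open>k[V]\<close> is generated by \<open>V\<close> as a \<open>k\<close>-algebra.  This form of induction turns statements about
  derivations and substitutions into statements about constants and variables.
\<close>

lemma polys_in_induct [consumes 1, case_names const var add mult]:
  fixes p :: "('v, 'a::comm_ring_1) mpoly"
  assumes "p \<in> polys_in V"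
    and const: "\<And>c. P (const c)" and var: "\<And>v. v \<in> V \<Longrightarrow> P (var v)"
    and add: "\<And>p q. p \<in> polys_in V \<Longrightarrow> q \<in> polys_in V \<Longrightarrow> P p \<Longrightarrow> P q \<Longrightarrow> P (p + q)"
    and mult: "\<And>p q. p \<in> polys_in V \<Longrightarrow> q \<in> polys_in V \<Longrightarrow> P p \<Longrightarrow> P q \<Longrightarrow> P (p * q)"
  shows "P p"
proof -
  let ?Q = "\<lambda>p. p \<in> polys_in V \<and> P p"
  have one: "?Q 1"
    using const[of 1] polys_in_const[of "1::'a" V] by (simp add: const_one)
  have power: "?Q (var v ^ n)" if "v \<in> V" for v n
    using that by (induction n) (use one in \<open>simp_all add: polys_in_mult mult var polys_in_var\<close>)
  have prod: "?Q (\<Prod>v\<in>S. var v ^ e v)" if "S \<subseteq> V" for S e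
    using that
  proof (induction S rule: infinite_finite_induct)
    case (insert v S)
    then have "?Q (var v ^ e v)" "?Q (\<Prod>v\<in>S. var v ^ e v)"
      using power by auto
    with insert.hyps show ?case
      by (simp add: polys_in_mult mult)
  qed (use one in auto)
  have single: "?Q (Poly_Mapping.single m c)" if "Poly_Mapping.keys m \<subseteq> V" for m c
    unfolding single_eq_const_mult_prod_var using prod[OF that, of "Poly_Mapping.lookup m"]
    by (auto intro!: polys_in_mult mult const)
  have zero: "?Q 0"
    using const[of 0] by (simp add: const_def)
  have sum: "?Q (\<Sum>m\<in>S. Poly_Mapping.single m (c m))"
    if "\<And>m. m \<in> S \<Longrightarrow> Poly_Mapping.keys m \<subseteq> V" for S c
    using that
  proof (induction S rule: infinite_finite_induct)
    case (insert m S)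
    then have "?Q (Poly_Mapping.single m (c m))" "?Q (\<Sum>m\<in>S. Poly_Mapping.single m (c m))"
      using single by auto
    with insert.hyps show ?case
      by (simp add: polys_in_add add)
  qed (use zero in auto)
  show ?thesis
    using sum[of "Poly_Mapping.keys p" "Poly_Mapping.lookup p"] assms(1)
    by (simp add: sum_single_lookup polys_in_def)
qed


section \<open>Partial derivatives, substitution and the chain rule\<close>

lemma partial_add:
  fixes p q :: "('v, 'a::comm_ring_1) mpoly"
  shows "partial v (p + q) = partial v p + partial v q"
  unfolding partial_def
  by (rule setsum_keys_plus_distrib) (simp_all add: distrib_left single_add)

lemma partial_single:
  "partial v (Poly_Mapping.single m c) =
    Poly_Mapping.single (m - Poly_Mapping.single v 1) (of_nat (Poly_Mapping.lookup m v) * c)"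
  by (simp add: partial_def)

lemma lookup_diff_nat:
  "Poly_Mapping.lookup (m - n) v = Poly_Mapping.lookup m v - (Poly_Mapping.lookup n v :: nat)"
  by (simp add: lookup_minus)

text \<open>
  For monomials, the Leibniz rule is the additivity of exponents; the truncated subtraction
  is harmless because it truncates only when the coefficient in front is zero.
\<close>

lemma partial_mult:
  fixes p q :: "('v, 'a::comm_ring_1) mpoly"
  shows "partial v (p * q) = partial v p * q + p * partial v q"
proof (rule additive_eqI[of "\<lambda>p. partial v (p * q)" "\<lambda>p. partial v p * q + p * partial v q"])
  fix m :: "'v \<Rightarrow>\<^sub>0 nat" and c :: 'a
  let ?s = "Poly_Mapping.single m c"
  show "partial v (?s * q) = partial v ?s * q + ?s * partial v q"
  proof (rule additive_eqI[of "\<lambda>q. partial v (?s * q)" "\<lambda>q. partial v ?s * q + ?s * partial v q"])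
    fix n :: "'v \<Rightarrow>\<^sub>0 nat" and d :: 'a
    let ?v = "Poly_Mapping.single v (1::nat)"
    have m: "m + n - ?v = (m - ?v) + n" if "Poly_Mapping.lookup m v \<noteq> 0"
      by (rule poly_mapping_eqI) (use that in \<open>auto simp: lookup_add lookup_diff_nat lookup_single when_def\<close>)
    have n: "m + n - ?v = m + (n - ?v)" if "Poly_Mapping.lookup n v \<noteq> 0"
      by (rule poly_mapping_eqI) (use that in \<open>auto simp: lookup_add lookup_diff_nat lookup_single when_def\<close>)
    show "partial v (?s * Poly_Mapping.single n d) =
      partial v ?s * Poly_Mapping.single n d + ?s * partial v (Poly_Mapping.single n d)"
      by (cases "Poly_Mapping.lookup m v = 0"; cases "Poly_Mapping.lookup n v = 0")
        (use m n in \<open>auto simp: partial_single mult_single lookup_add algebra_simps single_add\<close>)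
  qed (simp_all add: partial_add algebra_simps)
qed (simp_all add: partial_add algebra_simps)

lemma partial_const [simp]: "partial v (const c) = 0"
  by (simp add: const_def partial_single)

lemma partial_var: "partial v (var w) = of_bool (v = w)"
  by (simp add: var_def partial_single lookup_single when_def)

lemma partial_zero [simp]: "partial v 0 = 0"
  by (simp add: partial_def)

lemma partial_uminus:
  fixes p :: "('v, 'a::comm_ring_1) mpoly"
  shows "partial v (- p) = - partial v p"
  using partial_add[of v p "- p"] by (simp add: minus_unique)

lemma partial_diff:
  fixes p q :: "('v, 'a::comm_ring_1) mpoly"
  shows "partial v (p - q) = partial v p - partial v q"
  using partial_add[of v p "- q"] by (simp add: partial_uminus)

lemma partial_sum:
  fixes g :: "'i \<Rightarrow> ('v, 'a::comm_ring_1) mpoly"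
  shows "partial v (\<Sum>i\<in>S. g i) = (\<Sum>i\<in>S. partial v (g i))"
  by (rule additive_sum) (rule partial_add)

lemma partial_commute:
  fixes p :: "('v, 'a::comm_ring_1) mpoly"
  shows "partial v (partial w p) = partial w (partial v p)"
proof (rule additive_eqI[of "\<lambda>p. partial v (partial w p)"])
  fix m and c :: 'a
  have "m - Poly_Mapping.single w 1 - Poly_Mapping.single v 1 =
      m - Poly_Mapping.single v 1 - Poly_Mapping.single w (1::nat)"
    by (rule poly_mapping_eqI) (simp add: lookup_diff_nat)
  then show "partial v (partial w (Poly_Mapping.single m c)) =
      partial w (partial v (Poly_Mapping.single m c))"
    by (cases "v = w") (simp_all add: partial_single lookup_diff_nat lookup_single when_def mult_ac)
qed (simp_all add: partial_add)

lemma partial_in_polys_in: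
  fixes p :: "('v, 'a::comm_ring_1) mpoly"
  assumes "p \<in> polys_in V"
  shows "partial v p \<in> polys_in V"
  using assms
  by (induction p rule: polys_in_induct)
    (auto simp: partial_add partial_mult partial_var const_one[symmetric]
      intro: polys_in_add polys_in_mult polys_in_const[of 1, unfolded const_one])

lemma partial_outside:
  fixes p :: "('v, 'a::comm_ring_1) mpoly"
  assumes "p \<in> polys_in V" "v \<notin> V"
  shows "partial v p = 0"
  using assms by (induction p rule: polys_in_induct) (auto simp: partial_add partial_mult partial_var)

lemma subst_add:
  fixes F G :: "('j, 'a::comm_ring_1) mpoly"
  shows "subst f (F + G) = subst f F + subst f G"
  unfolding subst_def
  by (rule setsum_keys_plus_distrib) (simp_all add: const_add distrib_right, simp add: const_def)

lemma subst_single: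
  "subst f (Poly_Mapping.single m c) =
    const c * (\<Prod>j\<in>Poly_Mapping.keys m. f j ^ Poly_Mapping.lookup m j)"
  by (simp add: subst_def, simp add: const_def)

lemma subst_mult:
  fixes F G :: "('j, 'a::comm_ring_1) mpoly" and f :: "'j \<Rightarrow> ('v, 'a) mpoly"
  shows "subst f (F * G) = subst f F * subst f G"
proof (rule additive_eqI[of "\<lambda>F. subst f (F * G)" "\<lambda>F. subst f F * subst f G"])
  fix m :: "'j \<Rightarrow>\<^sub>0 nat" and c :: 'a
  let ?s = "Poly_Mapping.single m c"
  show "subst f (?s * G) = subst f ?s * subst f G"
  proof (rule additive_eqI[of "\<lambda>G. subst f (?s * G)" "\<lambda>G. subst f ?s * subst f G"])
    fix n :: "'j \<Rightarrow>\<^sub>0 nat" and d :: 'a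
    let ?K = "Poly_Mapping.keys m \<union> Poly_Mapping.keys n"
    have superset: "(\<Prod>j\<in>Poly_Mapping.keys l. f j ^ Poly_Mapping.lookup l j) =
        (\<Prod>j\<in>?K. f j ^ Poly_Mapping.lookup l j)"
      if "Poly_Mapping.keys l \<subseteq> ?K" for l
      by (rule prod.mono_neutral_left) (use that in \<open>auto simp: in_keys_iff\<close>)
    have sum: "(\<Prod>j\<in>?K. f j ^ Poly_Mapping.lookup (m + n) j) =
        (\<Prod>j\<in>?K. f j ^ Poly_Mapping.lookup m j) * (\<Prod>j\<in>?K. f j ^ Poly_Mapping.lookup n j)"
      by (simp add: lookup_add power_add prod.distrib)
    show "subst f (?s * Poly_Mapping.single n d) = subst f ?s * subst f (Poly_Mapping.single n d)"
      unfolding mult_single subst_single superset[OF keys_add] superset[OF Un_upper1]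
        superset[OF Un_upper2] sum const_mult
      by (simp only: mult_ac)
  qed (simp_all add: subst_add algebra_simps)
qed (simp_all add: subst_add algebra_simps)

lemma subst_const [simp]: "subst f (const c) = const c"
  by (simp add: const_def[of c] subst_single)

lemma subst_var: "subst f (var j) = f j"
  by (simp add: var_def subst_single const_one)

lemma subst_zero [simp]: "subst f 0 = 0"
  by (simp add: subst_def)

lemma subst_one [simp]: "subst f 1 = 1"
  using subst_const[of f 1] by (simp only: const_one)

lemma subst_uminus:
  fixes F :: "('j, 'a::comm_ring_1) mpoly"
  shows "subst f (- F) = - subst f F"
  using subst_add[of f F "- F"] by (simp add: minus_unique)

lemma subst_diff:
  fixes F :: "('j, 'a::comm_ring_1) mpoly"
  shows "subst f (F - G) = subst f F - subst f G"
  using subst_add[of f F "- G"] by (simp add: subst_uminus)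

lemma subst_in_polys_in:
  fixes F :: "('j, 'a::comm_ring_1) mpoly"
  assumes "F \<in> polys_in J" "\<And>j. j \<in> J \<Longrightarrow> f j \<in> polys_in V"
  shows "subst f F \<in> polys_in V"
  using assms
  by (induction F rule: polys_in_induct)
    (auto simp: subst_add subst_mult subst_var intro: polys_in_add polys_in_mult)

definition derivation :: "(('v, 'a::comm_ring_1) mpoly \<Rightarrow> ('v, 'a) mpoly) \<Rightarrow> bool" where
  "derivation D \<longleftrightarrow>
     (\<forall>p q. D (p + q) = D p + D q) \<and>
     (\<forall>p q. D (p * q) = D p * q + p * D q) \<and>
     (\<forall>c. D (const c) = 0)"

text \<open>
  Both sides are additive in \<open>F\<close> and satisfy the Leibniz rule along the substitution, so they agree
  once they agree on the variables \<open>T\<^sub>j\<close>.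
\<close>

lemma chain_rule:
  fixes F :: "('j, 'a::comm_ring_1) mpoly"
  assumes D: "derivation D" and "finite J" "F \<in> polys_in J"
  shows "D (subst f F) = (\<Sum>j\<in>J. subst f (partial j F) * D (f j))"
  using assms(3)
proof (induction F rule: polys_in_induct)
  case (var v)
  have "(\<Sum>j\<in>J. subst f (partial j (var v)) * D (f j)) = (\<Sum>j\<in>J. if j = v then D (f j) else 0)"
    by (rule sum.cong) (auto simp: partial_var)
  with var \<open>finite J\<close> show ?case
    by (simp add: subst_var)
qed (use D in \<open>simp_all add: derivation_def subst_add subst_mult partial_add partial_mult
        sum.distrib sum_distrib_left sum_distrib_right algebra_simps\<close>)

lemma derivation_partial: "derivation (partial v)"
  by (simp add: derivation_def partial_add partial_mult)


section \<open>The polar syzygy module\<close>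

lemma is_submodule_polar_syzygies:
  assumes "{(\<lambda>j. subst f (partial j F)) | F. F \<in> relation_ideal J f} \<subseteq> free_module V J"
  shows "is_submodule V J (polar_syzygies V J f)"
proof -
  let ?G = "{(\<lambda>j. subst f (partial j F)) | F. F \<in> relation_ideal J f}"
  have "is_submodule V J (free_module V J :: ('a \<Rightarrow> ('b, 'c) mpoly) set)"
    by (auto simp: is_submodule_def free_module_def intro: polys_in_add polys_in_mult)
  with assms have "polar_syzygies V J f \<subseteq> free_module V J"
    unfolding polar_syzygies_def by (rule hull_minimal)
  then show ?thesis
    unfolding polar_syzygies_def hull_def is_submodule_def by blast
qed

lemma polar_generators_subset_free_module:
  fixes f :: "'j \<Rightarrow> ('v, 'a::comm_ring_1) mpoly"
  assumes "\<And>j. j \<in> J \<Longrightarrow> f j \<in> polys_in V"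
  shows "{(\<lambda>j. subst f (partial j F)) | F. F \<in> relation_ideal J f} \<subseteq> free_module V J"
  using assms
  by (auto simp: free_module_def relation_ideal_def partial_outside
      intro!: subst_in_polys_in partial_in_polys_in)

text \<open>Differentiating \<open>F(f) = 0\<close> by the chain rule gives \<open>\<D> \<subseteq> \<ZZ>\<close> for every family \<open>f\<close>.\<close>

lemma polar_syzygies_subset_differential_syzygies:
  fixes f :: "'j \<Rightarrow> ('v, 'a::comm_ring_1) mpoly"
  assumes "finite J" "\<And>j. j \<in> J \<Longrightarrow> f j \<in> polys_in V"
  shows "polar_syzygies V J f \<subseteq> differential_syzygies V J f"
  unfolding polar_syzygies_def
proof (rule hull_minimal)
  have "(\<Sum>j\<in>J. subst f (partial j F) * partial v (f j)) = 0"
    if "F \<in> relation_ideal J f" for F v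
    using chain_rule[OF derivation_partial \<open>finite J\<close>, of F v f] that
    by (simp add: relation_ideal_def)
  then have "(\<Sum>j\<in>J. subst f (partial j F) * differential V (f j) v) = 0"
    if "F \<in> relation_ideal J f" for F v
    using that by (cases "v \<in> V") (simp_all add: differential_def)
  then show "{(\<lambda>j. subst f (partial j F)) | F. F \<in> relation_ideal J f} \<subseteq> differential_syzygies V J f"
    using polar_generators_subset_free_module[of J f V] assms(2)
    unfolding differential_syzygies_def by blast
  show "is_submodule V J (differential_syzygies V J f)"
    unfolding is_submodule_def
  proof (intro conjI ballI)
    fix z w assume "z \<in> differential_syzygies V J f" "w \<in> differential_syzygies V J f"
    then show "(\<lambda>i. z i + w i) \<in> differential_syzygies V J f"
      by (auto simp: differential_syzygies_def free_module_def fun_eq_iff distrib_right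
          sum.distrib polys_in_add)
  next
    fix r :: "('v, 'a) mpoly" and z assume "r \<in> polys_in V" "z \<in> differential_syzygies V J f"
    then show "(\<lambda>i. r * z i) \<in> differential_syzygies V J f"
      by (auto simp: differential_syzygies_def free_module_def fun_eq_iff mult.assoc
          sum_distrib_left[symmetric] polys_in_mult)
  qed (auto simp: differential_syzygies_def free_module_def)
qed

text \<open>
  A derivation that kills all \<open>f j\<close> kills \<open>k[f]\<close>, hence the coordinates of the generators of the
  polar syzygy module; by the Leibniz rule it then maps the module into itself.
\<close>

lemma derivation_preserves_polar_syzygies:
  fixes f :: "'j \<Rightarrow> ('v, 'a::comm_ring_1) mpoly"
  assumes "finite J" and f: "\<And>j. j \<in> J \<Longrightarrow> f j \<in> polys_in V"
    and D: "derivation D" and D_in: "\<And>p. p \<in> polys_in V \<Longrightarrow> D p \<in> polys_in V"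
    and D_f: "\<And>j. j \<in> J \<Longrightarrow> D (f j) = 0"
    and z: "z \<in> polar_syzygies V J f"
  shows "(\<lambda>j. D (z j)) \<in> polar_syzygies V J f"
proof -
  let ?M = "polar_syzygies V J f"
  have M: "is_submodule V J ?M"
    using f by (intro is_submodule_polar_syzygies polar_generators_subset_free_module)
  let ?N = "{z \<in> ?M. (\<lambda>j. D (z j)) \<in> ?M}"
  have zero: "D 0 = 0"
    using D unfolding derivation_def by (metis add_cancel_left_right)
  have "is_submodule V J ?N"
    unfolding is_submodule_def
  proof (intro conjI ballI)
    fix z w assume "z \<in> ?N" "w \<in> ?N"
    then show "(\<lambda>i. z i + w i) \<in> ?N"
      using M D by (auto simp: is_submodule_def derivation_def)
  next
    fix r :: "('v, 'a) mpoly" and z assume r: "r \<in> polys_in V" and z: "z \<in> ?N"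
    have "(\<lambda>i. D r * z i) \<in> ?M" "(\<lambda>i. r * D (z i)) \<in> ?M" "(\<lambda>i. r * z i) \<in> ?M"
      using M z r D_in[OF r] unfolding is_submodule_def by auto
    moreover have "(\<lambda>i. D r * z i + r * D (z i)) \<in> ?M"
      using calculation M unfolding is_submodule_def by auto
    ultimately show "(\<lambda>i. r * z i) \<in> ?N"
      using D by (auto simp: derivation_def)
  qed (use M zero in \<open>auto simp: is_submodule_def\<close>)
  moreover have "{(\<lambda>j. subst f (partial j F)) | F. F \<in> relation_ideal J f} \<subseteq> ?N"
  proof clarify
    fix F assume F: "F \<in> relation_ideal J f"
    have "D (subst f (partial j F)) = 0" for j
      using F D_f \<open>finite J\<close>
      by (subst chain_rule[OF D]) (auto simp: relation_ideal_def partial_in_polys_in)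
    moreover have "(\<lambda>j. subst f (partial j F)) \<in> ?M"
      unfolding polar_syzygies_def using F by (auto intro: hull_inc)
    ultimately show "(\<lambda>j. subst f (partial j F)) \<in> ?M \<and> (\<lambda>j. D (subst f (partial j F))) \<in> ?M"
      using M by (auto simp: is_submodule_def)
  qed
  ultimately have "?M \<subseteq> ?N"
    unfolding polar_syzygies_def[of V J f] by (intro hull_minimal) auto
  with z show ?thesis by blast
qed

lemma is_submodule_sum:
  assumes "is_submodule V J M" "\<And>i. i \<in> S \<Longrightarrow> g i \<in> M"
  shows "(\<lambda>j. \<Sum>i\<in>S. g i j) \<in> M"
  using assms(2)
proof (induction S rule: infinite_finite_induct)
  case (insert i S)
  with assms(1) have "(\<lambda>j. g i j + (\<Sum>i\<in>S. g i j)) \<in> M"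
    unfolding is_submodule_def by auto
  with insert.hyps show ?case by simp
qed (use assms(1) in \<open>auto simp: is_submodule_def\<close>)


section \<open>Polarization operators\<close>

text \<open>
  The derivation that replaces row \<open>r\<close> of the generic matrix by row \<open>s\<close>.  Such operators
  represent the Lie algebra \<open>gl\<^sub>2\<close> on \<open>R\<close>; those with \<open>r = s\<close> are the Euler operators of the rows.
\<close>

definition polarization :: "nat \<Rightarrow> nat \<Rightarrow> nat \<Rightarrow> (nat \<times> nat, 'a::comm_ring_1) mpoly \<Rightarrow> (nat \<times> nat, 'a) mpoly" where
  "polarization m r s p = (\<Sum>k\<in>{1..m}. var (s, k) * partial (r, k) p)"

lemma derivation_polarization: "derivation (polarization m r s)"
  by (simp add: derivation_def polarization_def partial_add partial_mult sum.distrib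
      sum_distrib_left sum_distrib_right algebra_simps)

lemma polarization_add: "polarization m r s (p + q) = polarization m r s p + polarization m r s q"
  and polarization_mult:
    "polarization m r s (p * q) = polarization m r s p * q + p * polarization m r s q"
  using derivation_polarization[of m r s] by (auto simp: derivation_def)

lemma polarization_zero [simp]: "polarization m r s 0 = 0"
  by (simp add: polarization_def)

lemma polarization_uminus: "polarization m r s (- p) = - polarization m r s p"
  by (simp add: polarization_def partial_uminus sum_negf)

lemma polarization_diff: "polarization m r s (p - q) = polarization m r s p - polarization m r s q"
  by (simp add: polarization_def partial_diff sum_subtractf algebra_simps)

lemma polarization_sum: "polarization m r s (\<Sum>i\<in>S. g i) = (\<Sum>i\<in>S. polarization m r s (g i))"
  by (rule additive_sum) (rule polarization_add)

lemma polarization_of_nat_mult: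
  fixes p :: "(nat \<times> nat, 'a::comm_ring_1) mpoly"
  shows "polarization m r s (of_nat n * p) = of_nat n * polarization m r s p"
proof -
  have "polarization m r s (const (of_nat n :: 'a)) = 0"
    using derivation_polarization[of m r s, where 'a = 'a] by (auto simp: derivation_def)
  then show ?thesis
    by (simp add: polarization_mult const_of_nat)
qed

lemma polarization_var:
  assumes "k \<in> {1..m}"
  shows "polarization m r s (var (t, k)) = of_bool (r = t) * var (s, k)"
proof -
  have "polarization m r s (var (t, k)) = (\<Sum>l\<in>{1..m}. if l = k then of_bool (r = t) * var (s, k) else 0)"
    unfolding polarization_def by (rule sum.cong) (auto simp: partial_var)
  then show ?thesis using assms by simp
qed

lemma polarization_in_polys_in:
  assumes "p \<in> polys_in (entry_indices m)" "s \<in> {1, 2}"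
  shows "polarization m r s p \<in> polys_in (entry_indices m)"
  unfolding polarization_def
  using assms by (intro polys_in_sum polys_in_mult polys_in_var partial_in_polys_in)
    (auto simp: entry_indices_def)

text \<open>
  A composition of two polarization operators splits into a first-order part, which arises when the
  outer operator differentiates a coefficient of the inner one, and a second-order part, which is
  symmetric in the two operators because partial derivatives commute.
\<close>

lemma polarization_polarization:
  "polarization m r s (polarization m r' s' p) =
    of_bool (r = s') * polarization m r' s p +
    (\<Sum>k\<in>{1..m}. \<Sum>l\<in>{1..m}. var (s, k) * var (s', l) * partial (r, k) (partial (r', l) p))"
proof -
  have "partial (r, k) (polarization m r' s' p) = of_bool (r = s') * partial (r', k) p +
      (\<Sum>l\<in>{1..m}. var (s', l) * partial (r, k) (partial (r', l) p))" if "k \<in> {1..m}" for k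
  proof -
    have "(\<Sum>l\<in>{1..m}. partial (r, k) (var (s', l)) * partial (r', l) p) =
        (\<Sum>l\<in>{1..m}. if l = k then of_bool (r = s') * partial (r', k) p else 0)"
      by (rule sum.cong) (auto simp: partial_var)
    with that show ?thesis
      by (simp add: polarization_def partial_sum partial_mult sum.distrib)
  qed
  then have "polarization m r s (polarization m r' s' p) =
      (\<Sum>k\<in>{1..m}. var (s, k) * (of_bool (r = s') * partial (r', k) p +
        (\<Sum>l\<in>{1..m}. var (s', l) * partial (r, k) (partial (r', l) p))))"
    unfolding polarization_def[of m r s] by (intro sum.cong refl arg_cong2[of _ _ _ _ "(*)"]) auto
  then show ?thesis
    unfolding polarization_def[of m r' s]
    by (simp add: distrib_left sum.distrib sum_distrib_left mult_ac)
qed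

text \<open>The commutation relations of the matrix units of \<open>gl\<^sub>2\<close>: only the first-order parts survive.\<close>

lemma polarization_commutator:
  "polarization m r s (polarization m r' s' p) - polarization m r' s' (polarization m r s p) =
    of_bool (r = s') * polarization m r' s p - of_bool (r' = s) * polarization m r s' p"
proof -
  have "(\<Sum>k\<in>{1..m}. \<Sum>l\<in>{1..m}. var (s, k) * var (s', l) * partial (r, k) (partial (r', l) p)) =
      (\<Sum>k\<in>{1..m}. \<Sum>l\<in>{1..m}. var (s', k) * var (s, l) * partial (r', k) (partial (r, l) p))"
    by (subst sum.swap) (simp add: mult_ac partial_commute[of "(r, _)"])
  then show ?thesis
    by (simp add: polarization_polarization)
qed

text \<open>Replacing one row of a two-rowed determinant by the other yields a determinant with equal rows.\<close>

lemma polarization_minor2: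
  assumes "j \<in> minor_indices m" "(r, s) = (1, 2) \<or> (r, s) = (2, 1)"
  shows "polarization m r s (minor2 j) = 0"
  using assms
  by (auto simp: minor_indices_def minor2_def generic_entry_def polarization_diff
      polarization_mult polarization_var)


section \<open>Bihomogeneous components\<close>

definition row_degree :: "nat \<Rightarrow> nat \<Rightarrow> (nat \<times> nat \<Rightarrow>\<^sub>0 nat) \<Rightarrow> nat" where
  "row_degree m r e = (\<Sum>k\<in>{1..m}. Poly_Mapping.lookup e (r, k))"

definition bidegree :: "nat \<Rightarrow> (nat \<times> nat \<Rightarrow>\<^sub>0 nat) \<Rightarrow> nat \<times> nat" where
  "bidegree m e = (row_degree m 1 e, row_degree m 2 e)"

definition component :: "nat \<Rightarrow> nat \<times> nat \<Rightarrow> (nat \<times> nat, 'a::comm_ring_1) mpoly \<Rightarrow> (nat \<times> nat, 'a) mpoly" where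
  "component m d p = (\<Sum>e\<in>Poly_Mapping.keys p.
     if bidegree m e = d then Poly_Mapping.single e (Poly_Mapping.lookup p e) else 0)"

text \<open>
  Bihomogeneity is expressed by Euler's identities: these are what the homotopy formula consumes, and
  they propagate through polarization operators by the commutation relations alone.
\<close>

definition bihomogeneous :: "nat \<Rightarrow> nat \<times> nat \<Rightarrow> (nat \<times> nat, 'a::comm_ring_1) mpoly \<Rightarrow> bool" where
  "bihomogeneous m d p \<longleftrightarrow>
     polarization m 1 1 p = of_nat (fst d) * p \<and> polarization m 2 2 p = of_nat (snd d) * p"

lemma component_add: "component m d (p + q) = component m d p + component m d q"
  unfolding component_def by (rule setsum_keys_plus_distrib) (simp_all add: single_add)

lemma component_single:
  "component m d (Poly_Mapping.single e c) =
    (if bidegree m e = d then Poly_Mapping.single e c else 0)"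
  by (simp add: component_def)

lemma component_zero [simp]: "component m d 0 = 0"
  by (simp add: component_def)

lemma component_sum: "component m d (\<Sum>i\<in>S. g i) = (\<Sum>i\<in>S. component m d (g i))"
  by (rule additive_sum) (rule component_add)

lemma component_uminus:
  "component m d (- p) = - component m d p"
  using component_add[of m d p "- p"] by (simp add: minus_unique)

lemma component_in_polys_in:
  "p \<in> polys_in V \<Longrightarrow> component m d p \<in> polys_in V"
  unfolding component_def by (rule polys_in_sum) (auto simp: polys_in_def)

lemma sum_components:
  assumes "finite B" "bidegree m ` Poly_Mapping.keys p \<subseteq> B"
  shows "(\<Sum>d\<in>B. component m d p) = p"
proof -
  have "(\<Sum>d\<in>B. component m d p) = (\<Sum>e\<in>Poly_Mapping.keys p. \<Sum>d\<in>B.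
      if bidegree m e = d then Poly_Mapping.single e (Poly_Mapping.lookup p e) else 0)"
    unfolding component_def by (rule sum.swap)
  also have "\<dots> = (\<Sum>e\<in>Poly_Mapping.keys p. Poly_Mapping.single e (Poly_Mapping.lookup p e))"
    using assms by (intro sum.cong) auto
  also have "\<dots> = p"
    by (rule sum_single_lookup)
  finally show ?thesis .
qed

lemma row_degree_add: "row_degree m r (e + e') = row_degree m r e + row_degree m r e'"
  by (simp add: row_degree_def lookup_add sum.distrib)

lemma row_degree_single:
  "k \<in> {1..m} \<Longrightarrow> row_degree m r (Poly_Mapping.single (s, k) 1) = of_bool (r = s)"
  by (auto simp: row_degree_def lookup_single when_def)

text \<open>
  Multiplication by an entry of row \<open>s\<close> shifts the bidegree by one in place \<open>s\<close>.  Hence the components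
  of a solution of \<open>\<Sum>\<^sub>j Z\<^sub>i\<^sub>j x\<^sub>s\<^sub>j = 0\<close> are solutions as well.
\<close>

lemma component_mult_var:
  assumes "k \<in> {1..m}"
  shows "component m (a + of_bool (s = 1), b + of_bool (s = 2)) (p * var (s, k)) =
    component m (a, b) p * var (s, k)"
  by (rule additive_eqI[of "\<lambda>p. component m _ (p * var (s, k))"])
    (use assms in \<open>auto simp: component_add distrib_right var_def mult_single component_single bidegree_def
      row_degree_add row_degree_single[unfolded One_nat_def]\<close>)

lemma polarization_single_same:
  "polarization m r r (Poly_Mapping.single e c) =
    Poly_Mapping.single e (of_nat (row_degree m r e) * c)"
proof -
  have "var (r, k) * partial (r, k) (Poly_Mapping.single e c) =
      Poly_Mapping.single e (of_nat (Poly_Mapping.lookup e (r, k)) * c)" for k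
  proof (cases "Poly_Mapping.lookup e (r, k) = 0")
    case False
    then have "Poly_Mapping.single (r, k) 1 + (e - Poly_Mapping.single (r, k) 1) = e"
      by (intro poly_mapping_eqI) (auto simp: lookup_add lookup_diff_nat lookup_single when_def)
    then show ?thesis
      by (simp add: var_def partial_single mult_single)
  qed (simp add: partial_single)
  moreover have "(\<Sum>k\<in>S. Poly_Mapping.single e (g k)) = Poly_Mapping.single e (\<Sum>k\<in>S. g k)" for S and g :: "nat \<Rightarrow> 'a"
    by (induction S rule: infinite_finite_induct) (auto simp: single_add)
  ultimately show ?thesis
    by (simp add: polarization_def row_degree_def sum_distrib_right)
qed

lemma of_nat_mult_single:
  "of_nat n * Poly_Mapping.single e c =
    (Poly_Mapping.single e (of_nat n * c) :: ('v, 'a::comm_ring_1) mpoly)"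
  by (simp add: const_of_nat[symmetric] const_def mult_single del: single_of_nat)

lemma bihomogeneous_component: "bihomogeneous m d (component m d p)"
proof -
  have "polarization m r r (component m d p) = of_nat n * component m d p"
    if "\<And>e. bidegree m e = d \<Longrightarrow> row_degree m r e = n" for r n
    by (rule additive_eqI[of "\<lambda>p. polarization m r r (component m d p)"])
      (use that in \<open>auto simp: component_add polarization_add distrib_left component_single
        polarization_single_same of_nat_mult_single\<close>)
  then show ?thesis
    unfolding bihomogeneous_def by (intro conjI) (simp_all add: bidegree_def prod_eq_iff)
qed

text \<open>
  The Euler operator of row \<open>r\<close> multiplies each term by its degree in that row.  In characteristic zero
  its kernel therefore consists of the polynomials that do not involve row \<open>r\<close>.
\<close>

lemma partial_eq_zero_if_degree_zero:
  fixes p :: "(nat \<times> nat, 'a::field_char_0) mpoly"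
  assumes "polarization m r r p = 0" "k \<in> {1..m}"
  shows "partial (r, k) p = 0"
proof -
  have "Poly_Mapping.lookup (polarization m r r p) e = of_nat (row_degree m r e) * Poly_Mapping.lookup p e" for e
    by (rule additive_eqI[of "\<lambda>p. Poly_Mapping.lookup (polarization m r r p) e"])
      (auto simp: polarization_add lookup_add distrib_left polarization_single_same lookup_single when_def)
  then have "row_degree m r e = 0" if "e \<in> Poly_Mapping.keys p" for e
    using assms(1) that by (auto simp: in_keys_iff)
  then have "Poly_Mapping.lookup e (r, k) = 0" if "e \<in> Poly_Mapping.keys p" for e
    using assms(2) that by (auto simp: row_degree_def)
  then show ?thesis
    unfolding partial_def by (auto intro!: sum.neutral)
qed


section \<open>Pluecker relations\<close>

definition det2 :: "nat \<Rightarrow> nat \<Rightarrow> (nat \<times> nat, 'a::comm_ring_1) mpoly" where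
  "det2 a b = var (1, a) * var (2, b) - var (1, b) * var (2, a)"

text \<open>
  The convention \<open>T\<^sub>b\<^sub>a = - T\<^sub>a\<^sub>b\<close>, \<open>T\<^sub>a\<^sub>a = 0\<close> gives a Pluecker relation for every quadruple of columns, so
  that sums can run over all quadruples instead of the increasing ones.
\<close>

definition skew_var :: "nat \<Rightarrow> nat \<Rightarrow> (nat \<times> nat, 'a::comm_ring_1) mpoly" where
  "skew_var a b = (if a < b then var (a, b) else if b < a then - var (b, a) else 0)"

definition plucker_relation :: "nat \<Rightarrow> nat \<Rightarrow> nat \<Rightarrow> nat \<Rightarrow> (nat \<times> nat, 'a::comm_ring_1) mpoly" where
  "plucker_relation a b c d =
     skew_var a b * skew_var c d - skew_var a c * skew_var b d + skew_var a d * skew_var b c"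

text \<open>The partial derivative of \<open>skew_var a b\<close> with respect to the variable \<open>pq\<close>.\<close>

definition skew_delta :: "nat \<times> nat \<Rightarrow> nat \<Rightarrow> nat \<Rightarrow> 'a::comm_ring_1" where
  "skew_delta pq a b = of_bool (pq = (a, b)) - of_bool (pq = (b, a))"

lemma minor2_eq_det2: "minor2 (a, b) = det2 a b"
  by (simp add: minor2_def generic_entry_def det2_def)

lemma subst_skew_var: "subst minor2 (skew_var a b) = det2 a b"
  by (auto simp: skew_var_def subst_var subst_uminus minor2_eq_det2 det2_def)

lemma partial_skew_var:
  assumes "pq \<in> minor_indices m"
  shows "partial pq (skew_var a b) = skew_delta pq a b"
  using assms by (auto simp: skew_var_def skew_delta_def minor_indices_def partial_var partial_uminus)

lemma plucker_relation_in_relation_ideal: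
  assumes "a \<in> {1..m}" "b \<in> {1..m}" "c \<in> {1..m}" "d \<in> {1..m}"
  shows "plucker_relation a b c d \<in> relation_ideal (minor_indices m) minor2"
proof -
  have skew: "skew_var i j \<in> polys_in (minor_indices m)" if "i \<in> {1..m}" "j \<in> {1..m}" for i j
    using that by (auto simp: skew_var_def minor_indices_def intro!: polys_in_var polys_in_uminus)
  have "det2 a b * det2 c d - det2 a c * det2 b d + det2 a d * det2 b c = 0"
    unfolding det2_def by (simp add: algebra_simps)
  with assms show ?thesis
    unfolding relation_ideal_def plucker_relation_def
    by (auto simp: subst_add subst_diff subst_mult subst_skew_var
        intro!: polys_in_add polys_in_diff polys_in_mult skew)
qed

lemma subst_of_bool: "subst f (of_bool b) = of_bool b"
  by (cases b) simp_all

lemma plucker_gradient: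
  assumes "pq \<in> minor_indices m"
  shows "subst minor2 (partial pq (plucker_relation a b c d)) =
    (skew_delta pq a b * det2 c d + det2 a b * skew_delta pq c d)
    - (skew_delta pq a c * det2 b d + det2 a c * skew_delta pq b d)
    + (skew_delta pq a d * det2 b c + det2 a d * skew_delta pq b c)"
proof -
  have const: "subst minor2 (skew_delta pq i j) = skew_delta pq i j" for i j
    by (simp only: skew_delta_def subst_diff subst_of_bool)
  show ?thesis
    by (simp only: plucker_relation_def partial_add partial_diff partial_mult subst_add subst_diff
        subst_mult subst_skew_var partial_skew_var[OF assms] const)
qed

lemma sum_skew_delta:
  assumes "p \<in> {1..m}" "q \<in> {1..m}"
  shows "(\<Sum>a\<in>{1..m}. \<Sum>b\<in>{1..m}. skew_delta (p, q) a b * g a b) = g p q - g q p"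
proof -
  have *: "(\<Sum>a\<in>{1..m}. \<Sum>b\<in>{1..m}. of_bool ((p, q) = (a, b)) * g a b) = g p q"
    if "p \<in> {1..m}" "q \<in> {1..m}" for p q
  proof -
    have "(\<Sum>a\<in>{1..m}. \<Sum>b\<in>{1..m}. of_bool ((p, q) = (a, b)) * g a b) =
        (\<Sum>a\<in>{1..m}. if a = p then \<Sum>b\<in>{1..m}. if b = q then g p q else 0 else 0)"
      by (intro sum.cong refl) (auto intro!: sum.cong)
    with that show ?thesis by simp
  qed
  have "((p, q) = (b, a)) = ((q, p) = (a, b))" for a b by auto
  then show ?thesis
    using *[of p q] *[of q p] assms
    by (simp only: skew_delta_def left_diff_distrib sum_subtractf)
qed


section \<open>Skew matrices annihilating the rows\<close>

text \<open>
  The matrices that correspond to the elements \<open>\<omega>\<close> of \<open>\<Lambda>\<^sup>2R\<^sup>m\<close> whose contractions with both rows vanish.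
\<close>

definition null_matrix :: "nat \<Rightarrow> (nat \<Rightarrow> nat \<Rightarrow> (nat \<times> nat, 'a::comm_ring_1) mpoly) \<Rightarrow> bool" where
  "null_matrix m Z \<longleftrightarrow>
     (\<forall>i j. Z i j \<in> polys_in (entry_indices m)) \<and>
     (\<forall>i j. Z j i = - Z i j) \<and>
     (\<forall>i\<in>{1..m}. \<forall>s\<in>{1, 2}. (\<Sum>j\<in>{1..m}. Z i j * var (s, j)) = 0)"

lemma null_matrix_in_polys_in: "null_matrix m Z \<Longrightarrow> Z i j \<in> polys_in (entry_indices m)"
  and null_matrix_skew: "null_matrix m Z \<Longrightarrow> Z j i = - Z i j"
  and null_matrix_row: "null_matrix m Z \<Longrightarrow> i \<in> {1..m} \<Longrightarrow> s \<in> {1, 2} \<Longrightarrow>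
    (\<Sum>j\<in>{1..m}. Z i j * var (s, j)) = 0"
  unfolding null_matrix_def by blast+

definition upper_part :: "nat \<Rightarrow> (nat \<Rightarrow> nat \<Rightarrow> 'b::zero) \<Rightarrow> nat \<times> nat \<Rightarrow> 'b" where
  "upper_part m Z = (\<lambda>(i, j). if (i, j) \<in> minor_indices m then Z i j else 0)"

lemma partial_minor2:
  "partial (1, k) (minor2 (a, b)) = of_bool (a = k) * var (2, b) - of_bool (b = k) * var (2, a)"
  "partial (2, k) (minor2 (a, b)) = of_bool (b = k) * var (1, a) - of_bool (a = k) * var (1, b)"
  by (auto simp: minor2_eq_det2 det2_def partial_diff partial_mult partial_var)

text \<open>
  The derivative of a minor with respect to an entry is, up to sign, the entry of the other row in the
  other column.  The coordinates at row \<open>r\<close> of the syzygy condition therefore say that the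
  skew-symmetric extension \<open>Z\<close> of \<open>z\<close> annihilates the row different from \<open>r\<close>.
\<close>

lemma differential_syzygy_null_matrix:
  fixes z :: "nat \<times> nat \<Rightarrow> (nat \<times> nat, 'a::comm_ring_1) mpoly"
  assumes "z \<in> differential_syzygies (entry_indices m) (minor_indices m) minor2"
  defines "Z \<equiv> \<lambda>i j. z (i, j) - z (j, i)"
  shows "null_matrix m Z" and "upper_part m Z = z"
proof -
  let ?V = "entry_indices m" and ?J = "minor_indices m" and ?I = "{1..m}"
  have z_in: "z j \<in> polys_in ?V" for j
    using assms(1) polys_in_zero[of ?V]
    by (cases "j \<in> ?J") (simp_all add: differential_syzygies_def free_module_def del: split_paired_All)
  have z_zero: "z j = 0" if "j \<notin> ?J" for j
    using assms(1) that unfolding differential_syzygies_def free_module_def by blast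
  have row: "(\<Sum>a\<in>?I. \<Sum>b\<in>?I. z (a, b) * partial (r, k) (minor2 (a, b))) = 0"
    if "(r, k) \<in> ?V" for r k
  proof -
    have "(\<Sum>a\<in>?I. \<Sum>b\<in>?I. z (a, b) * partial (r, k) (minor2 (a, b))) =
        (\<Sum>j\<in>?I \<times> ?I. z j * partial (r, k) (minor2 j))"
      by (simp add: sum.cartesian_product split_beta)
    also have "\<dots> = (\<Sum>j\<in>?J. z j * partial (r, k) (minor2 j))"
      by (rule sum.mono_neutral_right) (auto simp: minor_indices_def z_zero)
    also have "\<dots> = 0"
      using assms(1) that by (auto simp: differential_syzygies_def differential_def dest: fun_cong[of _ _ "(r, k)"])
    finally show ?thesis .
  qed
  have select: "(\<Sum>a\<in>?I. \<Sum>b\<in>?I. z (a, b) * (of_bool (a = k) * u b - of_bool (b = k) * u a)) =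
      (\<Sum>j\<in>?I. Z k j * u j)" if "k \<in> ?I" for k and u :: "nat \<Rightarrow> (nat \<times> nat, 'a) mpoly"
  proof -
    have "(\<Sum>a\<in>?I. \<Sum>b\<in>?I. z (a, b) * (of_bool (a = k) * u b)) =
        (\<Sum>a\<in>?I. if a = k then \<Sum>b\<in>?I. z (k, b) * u b else 0)"
      by (intro sum.cong refl) auto
    moreover have "(\<Sum>a\<in>?I. \<Sum>b\<in>?I. z (a, b) * (of_bool (b = k) * u a)) =
        (\<Sum>a\<in>?I. \<Sum>b\<in>?I. if b = k then z (a, k) * u a else 0)"
      by (intro sum.cong refl) auto
    ultimately show ?thesis
      using that by (simp add: Z_def right_diff_distrib left_diff_distrib sum_subtractf)
  qed
  have "(\<Sum>j\<in>?I. Z k j * var (2, j)) = 0" if "k \<in> ?I" for k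
    using row[of 1 k] select[OF that, of "\<lambda>b. var (2, b)"] that
    by (simp add: partial_minor2 entry_indices_def del: One_nat_def)
  moreover have "(\<Sum>j\<in>?I. Z k j * var (1, j)) = 0" if "k \<in> ?I" for k
  proof -
    have "(\<Sum>a\<in>?I. \<Sum>b\<in>?I. z (a, b) * partial (2, k) (minor2 (a, b))) =
        - (\<Sum>a\<in>?I. \<Sum>b\<in>?I. z (a, b) * (of_bool (a = k) * var (1, b) - of_bool (b = k) * var (1, a)))"
      unfolding sum_negf[symmetric] partial_minor2 by (simp add: algebra_simps)
    then show ?thesis
      using row[of 2 k] select[OF that, of "\<lambda>b. var (1, b)"] that
      by (simp add: entry_indices_def)
  qed
  ultimately show "null_matrix m Z"
    unfolding null_matrix_def using z_in by (auto simp: Z_def intro!: polys_in_diff)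
  show "upper_part m Z = z"
  proof
    fix pq show "upper_part m Z pq = z pq"
      using z_zero[of pq] z_zero[of "prod.swap pq"]
      by (cases pq) (auto simp: upper_part_def Z_def minor_indices_def)
  qed
qed

lemma null_matrix_component:
  assumes "null_matrix m Z"
  shows "null_matrix m (\<lambda>i j. component m (a, b) (Z i j))"
  unfolding null_matrix_def
proof (intro conjI allI ballI)
  fix i s assume "i \<in> {1..m}" "s \<in> {1, 2::nat}"
  have "(\<Sum>j\<in>{1..m}. component m (a, b) (Z i j) * var (s, j)) =
      component m (a + of_bool (s = 1), b + of_bool (s = 2)) (\<Sum>j\<in>{1..m}. Z i j * var (s, j))"
    unfolding component_sum by (intro sum.cong refl component_mult_var[symmetric])
  also have "\<dots> = 0"
    using null_matrix_row[OF assms \<open>i \<in> {1..m}\<close> \<open>s \<in> {1, 2}\<close>] by simp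
  finally show "(\<Sum>j\<in>{1..m}. component m (a, b) (Z i j) * var (s, j)) = 0" .
next
  fix i j
  show "component m (a, b) (Z i j) \<in> polys_in (entry_indices m)"
    using null_matrix_in_polys_in[OF assms] by (rule component_in_polys_in)
  show "component m (a, b) (Z j i) = - component m (a, b) (Z i j)"
    unfolding null_matrix_skew[OF assms, of j i] by (rule component_uminus)
qed

text \<open>
  Differentiating \<open>Zx\<^sub>t = 0\<close> leaves the extra term \<open>Zx\<^sub>s\<close> if \<open>t = r\<close>, and this term vanishes too because \<open>Z\<close>
  annihilates both rows.
\<close>

lemma null_matrix_polarization:
  assumes "null_matrix m Z" "r \<in> {1, 2}" "s \<in> {1, 2}"
  shows "null_matrix m (\<lambda>i j. polarization m r s (Z i j))"
  unfolding null_matrix_def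
proof (intro conjI allI ballI)
  fix i t assume i: "i \<in> {1..m}" and t: "t \<in> {1, 2::nat}"
  have null: "(\<Sum>j\<in>{1..m}. Z i j * var (t, j)) = 0" if "t \<in> {1, 2}" for t
    using assms(1) i that by (rule null_matrix_row)
  have "0 = polarization m r s (\<Sum>j\<in>{1..m}. Z i j * var (t, j))"
    by (simp only: null[OF t] polarization_zero)
  also have "\<dots> = (\<Sum>j\<in>{1..m}. polarization m r s (Z i j) * var (t, j) + of_bool (r = t) * (Z i j * var (s, j)))"
    unfolding polarization_sum
    by (intro sum.cong refl) (simp add: polarization_mult polarization_var)
  also have "\<dots> = (\<Sum>j\<in>{1..m}. polarization m r s (Z i j) * var (t, j))"
    by (simp only: sum.distrib sum_distrib_left[symmetric] null[OF assms(3)] mult_zero_right add_0_right)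
  finally show "(\<Sum>j\<in>{1..m}. polarization m r s (Z i j) * var (t, j)) = 0" ..
next
  fix i j
  show "polarization m r s (Z i j) \<in> polys_in (entry_indices m)"
    using null_matrix_in_polys_in[OF assms(1)] assms(3) by (rule polarization_in_polys_in)
  show "polarization m r s (Z j i) = - polarization m r s (Z i j)"
    unfolding null_matrix_skew[OF assms(1), of j i] by (rule polarization_uminus)
qed


section \<open>The homotopy formula\<close>

lemma sum_swap_middle:
  "(\<Sum>k\<in>I. \<Sum>l\<in>I. \<Sum>i\<in>I. \<Sum>j\<in>I. g k l i j) = (\<Sum>k\<in>I. \<Sum>i\<in>I. \<Sum>l\<in>I. \<Sum>j\<in>I. g k l i j)"
  by (intro sum.cong refl sum.swap)

lemma sum_swap_pairs:
  "(\<Sum>k\<in>I. \<Sum>l\<in>I. \<Sum>i\<in>I. \<Sum>j\<in>I. g k l i j) = (\<Sum>i\<in>I. \<Sum>j\<in>I. \<Sum>k\<in>I. \<Sum>l\<in>I. g k l i j)"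
proof -
  have "(\<Sum>k\<in>I. \<Sum>l\<in>I. \<Sum>i\<in>I. \<Sum>j\<in>I. g k l i j) = (\<Sum>i\<in>I. \<Sum>k\<in>I. \<Sum>l\<in>I. \<Sum>j\<in>I. g k l i j)"
    by (subst sum_swap_middle) (rule sum.swap)
  also have "\<dots> = (\<Sum>i\<in>I. \<Sum>k\<in>I. \<Sum>j\<in>I. \<Sum>l\<in>I. g k l i j)"
    by (intro sum.cong refl sum.swap)
  also have "\<dots> = (\<Sum>i\<in>I. \<Sum>j\<in>I. \<Sum>k\<in>I. \<Sum>l\<in>I. g k l i j)"
    by (intro sum.cong refl sum.swap)
  finally show ?thesis .
qed

text \<open>
  In terms of the contractions \<open>\<iota>\<^sub>x\<close>, \<open>\<iota>\<^sub>y\<close> with the rows and of \<open>d\<^sub>x = \<Sum>\<^sub>k e\<^sub>k \<and> \<partial>/\<partial>x\<^sub>k\<close>, \<open>d\<^sub>y = \<Sum>\<^sub>k e\<^sub>k \<and> \<partial>/\<partial>y\<^sub>k\<close>,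
  the left-hand side is twice the coordinate at \<open>(p, q)\<close> of \<open>\<iota>\<^sub>y\<iota>\<^sub>xd\<^sub>xd\<^sub>y\<omega>\<close>; the factor two is due to the sum
  over all pairs \<open>(i, j)\<close> in place of \<open>i < j\<close>.  Moving \<open>\<iota>\<^sub>x\<close> and \<open>\<iota>\<^sub>y\<close> to the right, where they kill \<open>\<omega>\<close>, leaves
  only anticommutators: \<open>\<iota>\<^sub>xd\<^sub>x + d\<^sub>x\<iota>\<^sub>x\<close> is multiplication by the degree in \<open>x\<close> plus the form degree, which
  yields \<open>a + 3\<close> on \<open>d\<^sub>y\<omega>\<close>, likewise \<open>\<iota>\<^sub>yd\<^sub>y + d\<^sub>y\<iota>\<^sub>y\<close> yields \<open>b + 2\<close> on \<open>\<omega>\<close>, and the mixed anticommutators are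
  polarization operators.  The proof carries this out in coordinates.
\<close>

lemma homotopy_formula:
  fixes Z :: "nat \<Rightarrow> nat \<Rightarrow> (nat \<times> nat, 'a::comm_ring_1) mpoly"
  assumes Z: "null_matrix m Z" and bihom: "\<And>i j. bihomogeneous m (a, b) (Z i j)"
    and pq: "(p, q) \<in> minor_indices m"
  shows "(\<Sum>k\<in>{1..m}. \<Sum>l\<in>{1..m}. \<Sum>i\<in>{1..m}. \<Sum>j\<in>{1..m}. partial (1, k) (partial (2, l) (Z i j)) *
      subst minor2 (partial (p, q) (plucker_relation k l i j))) =
    2 * (of_nat ((a + 3) * (b + 2)) * Z p q - polarization m 1 2 (polarization m 2 1 (Z p q)))"
proof -
  define I where "I = {1..m}"
  have finite: "finite I"
    by (simp add: I_def)
  have p: "p \<in> I" and q: "q \<in> I"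
    using pq by (auto simp: minor_indices_def I_def)
  define A where "A k l i j = partial (1, k) (partial (2, l) (Z i j))" for k l i j
  define e :: "nat \<Rightarrow> nat \<Rightarrow> (nat \<times> nat, 'a) mpoly" where "e = skew_delta (p, q)"
  define x y :: "nat \<Rightarrow> (nat \<times> nat, 'a) mpoly" where "x = (\<lambda>k. var (1, k))" and "y = (\<lambda>k. var (2, k))"
  have delta: "(\<Sum>u\<in>I. \<Sum>v\<in>I. e u v * g u v) = g p q - g q p" for g
    using sum_skew_delta[of p m q g] p q by (simp only: I_def e_def)
  have skew: "Z j i = - Z i j" for i j
    using Z by (rule null_matrix_skew)
  have A_skew: "A k l j i = - A k l i j" for k l i j
    unfolding A_def by (subst skew) (simp add: partial_uminus)
  have det2: "det2 k l = x k * y l - y k * x l" for k l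
    by (simp add: det2_def x_def y_def mult.commute)

  have first: "(\<Sum>j\<in>I. var (s, j) * partial (r, l) (Z i j)) = - of_bool (r = s) * Z i l"
    if "i \<in> I" "l \<in> I" "s \<in> {1, 2}" for r s i l
  proof -
    have "(\<Sum>j\<in>I. Z i j * var (s, j)) = 0"
      using Z that(1,3) unfolding I_def by (rule null_matrix_row)
    then have "0 = partial (r, l) (\<Sum>j\<in>I. Z i j * var (s, j))"
      by simp
    also have "\<dots> = (\<Sum>j\<in>I. var (s, j) * partial (r, l) (Z i j)) +
        (\<Sum>j\<in>I. if j = l then of_bool (r = s) * Z i l else 0)"
      unfolding partial_sum sum.distrib[symmetric]
      by (intro sum.cong refl) (auto simp: partial_mult partial_var mult.commute)
    finally show ?thesis
      using that(2) finite by (simp add: eq_neg_iff_add_eq_0)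
  qed
  have x_x: "(\<Sum>j\<in>I. x j * partial (1, l) (Z i j)) = - Z i l"
    and x_y: "(\<Sum>j\<in>I. x j * partial (2, l) (Z i j)) = 0"
    and y_y: "(\<Sum>j\<in>I. y j * partial (2, l) (Z i j)) = - Z i l"
    if "i \<in> I" "l \<in> I" for i l
    using first[OF that] by (simp_all add: x_def y_def)
  have y_A: "(\<Sum>j\<in>I. y j * A k l i j) = - partial (1, k) (Z i l)"
    if "i \<in> I" "l \<in> I" for k l i
    using arg_cong[OF y_y[OF that], of "partial (1, k)"]
    by (simp add: partial_sum partial_mult partial_uminus A_def y_def partial_var)
  have x_A: "(\<Sum>j\<in>I. x j * A k l i j) = - partial (2, l) (Z i k)"
    if "i \<in> I" "k \<in> I" for k l i
    using arg_cong[OF x_x[OF that], of "partial (2, l)"]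
    by (simp add: partial_sum partial_mult partial_uminus A_def x_def partial_var
        partial_commute[of "(Suc 0, k)"])
  have y_A': "(\<Sum>j\<in>I. y j * A k l i j) = partial (1, k) (Z l i)"
    if "i \<in> I" "l \<in> I" for k l i
    using y_A[OF that] by (simp add: skew[of l i] partial_uminus)
  have x_A': "(\<Sum>j\<in>I. x j * A k l i j) = partial (2, l) (Z k i)"
    if "i \<in> I" "k \<in> I" for k l i
    using x_A[OF that] by (simp add: skew[of k i] partial_uminus)
  have euler_x: "(\<Sum>k\<in>I. x k * partial (1, k) (Z i j)) = of_nat a * Z i j"
    and euler_y: "(\<Sum>k\<in>I. y k * partial (2, k) (Z i j)) = of_nat b * Z i j" for i j
    using bihom[of i j] by (simp_all add: bihomogeneous_def polarization_def x_def y_def I_def)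

  \<comment> \<open>Each of the six terms of a Pluecker gradient matches two of the indices \<open>k, l, i, j\<close> with \<open>(p, q)\<close> and
    leaves a minor on the other two, over which one sums.  \<open>T1\<close> to \<open>T4\<close> evaluate these sums over \<open>i, j\<close>,
    over \<open>k, l\<close>, over \<open>l, j\<close> and over \<open>k, i\<close>; \<open>S1\<close> to \<open>S4\<close> then carry out the matching.\<close>
  have contract: "(\<Sum>u\<in>I. \<Sum>v\<in>I. g u v * det2 u v) =
      (\<Sum>u\<in>I. x u * (\<Sum>v\<in>I. y v * g u v)) - (\<Sum>u\<in>I. y u * (\<Sum>v\<in>I. x v * g u v))" for g
    by (simp add: det2 sum_distrib_left sum_subtractf[symmetric] algebra_simps)

  have T1: "(\<Sum>i\<in>I. \<Sum>j\<in>I. A u v i j * det2 i j) = 2 * Z u v" if "u \<in> I" "v \<in> I" for u v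
  proof -
    have "(\<Sum>i\<in>I. \<Sum>j\<in>I. A u v i j * det2 i j) =
        (\<Sum>i\<in>I. x i * partial (1, u) (Z v i)) - (\<Sum>i\<in>I. y i * partial (2, v) (Z u i))"
      unfolding contract using that
      by (simp add: y_A' x_A' cong: sum.cong)
    also have "\<dots> = 2 * Z u v"
      using that by (simp add: x_x y_y skew[of u v] del: One_nat_def)
    finally show ?thesis .
  qed
  have T2: "(\<Sum>k\<in>I. \<Sum>l\<in>I. A k l u v * det2 k l) =
      of_nat (a * b + b) * Z u v - polarization m 1 2 (polarization m 2 1 (Z u v))" for u v
  proof -
    have "(\<Sum>k\<in>I. \<Sum>l\<in>I. A k l u v * det2 k l) =
        (\<Sum>k\<in>I. \<Sum>l\<in>I. x k * y l * A k l u v) - (\<Sum>k\<in>I. \<Sum>l\<in>I. y k * x l * A k l u v)"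
      by (simp add: det2 sum_subtractf[symmetric] algebra_simps)
    also have "(\<Sum>k\<in>I. \<Sum>l\<in>I. x k * y l * A k l u v) = polarization m 1 1 (polarization m 2 2 (Z u v))"
      by (simp add: polarization_polarization x_def y_def A_def I_def)
    also have "\<dots> = of_nat (a * b) * Z u v"
      using bihom[of u v] by (simp add: bihomogeneous_def polarization_of_nat_mult mult_ac)
    also have "(\<Sum>k\<in>I. \<Sum>l\<in>I. y k * x l * A k l u v) =
        polarization m 1 2 (polarization m 2 1 (Z u v)) - polarization m 2 2 (Z u v)"
      by (simp add: polarization_polarization x_def y_def A_def I_def)
    also have "polarization m 2 2 (Z u v) = of_nat b * Z u v"
      using bihom[of u v] by (simp add: bihomogeneous_def)
    finally show ?thesis
      by (simp add: algebra_simps)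
  qed
  have T3: "(\<Sum>l\<in>I. \<Sum>j\<in>I. A u l v j * det2 l j) = of_nat (b + 1) * Z v u"
    if "u \<in> I" "v \<in> I" for u v
  proof -
    have "(\<Sum>l\<in>I. \<Sum>j\<in>I. A u l v j * det2 l j) =
        - (\<Sum>l\<in>I. x l * partial (1, u) (Z v l)) + (\<Sum>l\<in>I. y l * partial (2, l) (Z v u))"
      unfolding contract using that by (simp add: y_A x_A sum_negf cong: sum.cong)
    also have "\<dots> = of_nat (b + 1) * Z v u"
      using that by (simp add: x_x euler_y algebra_simps del: One_nat_def)
    finally show ?thesis .
  qed
  have T4: "(\<Sum>k\<in>I. \<Sum>i\<in>I. A k u i v * det2 k i) = of_nat (a + 1) * Z v u"
    if "u \<in> I" "v \<in> I" for u v
  proof -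
    have "(\<Sum>k\<in>I. \<Sum>i\<in>I. A k u i v * det2 k i) =
        (\<Sum>k\<in>I. x k * partial (1, k) (Z v u)) - (\<Sum>k\<in>I. y k * partial (2, u) (Z v k))"
      unfolding contract A_skew[of _ u _ v] using that
      by (simp add: y_A x_A sum_negf cong: sum.cong)
    also have "\<dots> = of_nat (a + 1) * Z v u"
      using that by (simp add: y_y euler_x algebra_simps del: One_nat_def)
    finally show ?thesis .
  qed

  have S1: "(\<Sum>k\<in>I. \<Sum>l\<in>I. \<Sum>i\<in>I. \<Sum>j\<in>I. A k l i j * (e k l * det2 i j)) = 2 * Z p q - 2 * Z q p"
  proof -
    have "(\<Sum>k\<in>I. \<Sum>l\<in>I. \<Sum>i\<in>I. \<Sum>j\<in>I. A k l i j * (e k l * det2 i j)) =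
        (\<Sum>k\<in>I. \<Sum>l\<in>I. e k l * (\<Sum>i\<in>I. \<Sum>j\<in>I. A k l i j * det2 i j))"
      by (simp add: sum_distrib_left mult.left_commute)
    also have "\<dots> = 2 * Z p q - 2 * Z q p"
      unfolding delta by (simp only: T1 p q)
    finally show ?thesis .
  qed
  let ?P = "\<lambda>u v. polarization m 1 2 (polarization m 2 1 (Z u v))"
  have S2: "(\<Sum>k\<in>I. \<Sum>l\<in>I. \<Sum>i\<in>I. \<Sum>j\<in>I. A k l i j * (det2 k l * e i j)) =
      (of_nat (a * b + b) * Z p q - ?P p q) - (of_nat (a * b + b) * Z q p - ?P q p)"
  proof -
    have "(\<Sum>k\<in>I. \<Sum>l\<in>I. \<Sum>i\<in>I. \<Sum>j\<in>I. A k l i j * (det2 k l * e i j)) =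
        (\<Sum>i\<in>I. \<Sum>j\<in>I. e i j * (\<Sum>k\<in>I. \<Sum>l\<in>I. A k l i j * det2 k l))"
      by (subst sum_swap_pairs) (simp add: sum_distrib_left mult_ac)
    also have "\<dots> = (of_nat (a * b + b) * Z p q - ?P p q) - (of_nat (a * b + b) * Z q p - ?P q p)"
      unfolding delta by (simp only: T2)
    finally show ?thesis .
  qed
  have S3: "(\<Sum>k\<in>I. \<Sum>l\<in>I. \<Sum>i\<in>I. \<Sum>j\<in>I. A k l i j * (e k i * det2 l j)) =
      of_nat (b + 1) * Z q p - of_nat (b + 1) * Z p q"
  proof -
    have "(\<Sum>k\<in>I. \<Sum>l\<in>I. \<Sum>i\<in>I. \<Sum>j\<in>I. A k l i j * (e k i * det2 l j)) =
        (\<Sum>k\<in>I. \<Sum>i\<in>I. e k i * (\<Sum>l\<in>I. \<Sum>j\<in>I. A k l i j * det2 l j))"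
      by (subst sum_swap_middle) (simp add: sum_distrib_left mult.left_commute)
    also have "\<dots> = of_nat (b + 1) * Z q p - of_nat (b + 1) * Z p q"
      unfolding delta by (simp only: T3 p q)
    finally show ?thesis .
  qed
  have S4: "(\<Sum>k\<in>I. \<Sum>l\<in>I. \<Sum>i\<in>I. \<Sum>j\<in>I. A k l i j * (det2 k i * e l j)) =
      of_nat (a + 1) * Z q p - of_nat (a + 1) * Z p q"
  proof -
    have "(\<Sum>k\<in>I. \<Sum>l\<in>I. \<Sum>i\<in>I. \<Sum>j\<in>I. A k l i j * (det2 k i * e l j)) =
        (\<Sum>l\<in>I. \<Sum>j\<in>I. e l j * (\<Sum>k\<in>I. \<Sum>i\<in>I. A k l i j * det2 k i))"
      by (subst sum_swap_middle, subst sum_swap_pairs) (simp add: sum_distrib_left mult_ac)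
    also have "\<dots> = of_nat (a + 1) * Z q p - of_nat (a + 1) * Z p q"
      unfolding delta by (simp only: T4 p q)
    finally show ?thesis .
  qed
  have S34: "(\<Sum>k\<in>I. \<Sum>l\<in>I. \<Sum>i\<in>I. \<Sum>j\<in>I. A k l i j * (e k i * det2 l j + det2 k i * e l j)) =
      (of_nat (b + 1) * Z q p - of_nat (b + 1) * Z p q) +
      (of_nat (a + 1) * Z q p - of_nat (a + 1) * Z p q)"
    by (simp only: distrib_left sum.distrib S3 S4)
  \<comment> \<open>Exchanging \<open>i\<close> and \<open>j\<close> turns the last two terms of the gradient into the middle two, and the sign
    change of \<open>Z\<close> makes them add up.\<close>
  have S5: "(\<Sum>k\<in>I. \<Sum>l\<in>I. \<Sum>i\<in>I. \<Sum>j\<in>I. A k l i j * (e k j * det2 l i + det2 k j * e l i)) =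
      - (\<Sum>k\<in>I. \<Sum>l\<in>I. \<Sum>i\<in>I. \<Sum>j\<in>I. A k l i j * (e k i * det2 l j + det2 k i * e l j))"
  proof -
    have "(\<Sum>i\<in>I. \<Sum>j\<in>I. A k l i j * (e k j * det2 l i + det2 k j * e l i)) =
        - (\<Sum>i\<in>I. \<Sum>j\<in>I. A k l i j * (e k i * det2 l j + det2 k i * e l j))" for k l
      by (subst sum.swap, subst A_skew) (simp add: sum_negf)
    then show ?thesis
      by (simp add: sum_negf)
  qed

  have "(\<Sum>k\<in>I. \<Sum>l\<in>I. \<Sum>i\<in>I. \<Sum>j\<in>I. A k l i j * subst minor2 (partial (p, q) (plucker_relation k l i j))) =
      (\<Sum>k\<in>I. \<Sum>l\<in>I. \<Sum>i\<in>I. \<Sum>j\<in>I. A k l i j * (e k l * det2 i j)) +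
      (\<Sum>k\<in>I. \<Sum>l\<in>I. \<Sum>i\<in>I. \<Sum>j\<in>I. A k l i j * (det2 k l * e i j)) -
      (\<Sum>k\<in>I. \<Sum>l\<in>I. \<Sum>i\<in>I. \<Sum>j\<in>I. A k l i j * (e k i * det2 l j + det2 k i * e l j)) +
      (\<Sum>k\<in>I. \<Sum>l\<in>I. \<Sum>i\<in>I. \<Sum>j\<in>I. A k l i j * (e k j * det2 l i + det2 k j * e l i))"
    unfolding plucker_gradient[OF pq] e_def[symmetric] sum.distrib[symmetric] sum_subtractf[symmetric]
    by (intro sum.cong refl) (simp only: distrib_left right_diff_distrib)
  also have "\<dots> = (2 * Z p q - 2 * Z q p) +
      ((of_nat (a * b + b) * Z p q - ?P p q) - (of_nat (a * b + b) * Z q p - ?P q p)) -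
      2 * ((of_nat (b + 1) * Z q p - of_nat (b + 1) * Z p q) +
        (of_nat (a + 1) * Z q p - of_nat (a + 1) * Z p q))"
    unfolding S5 S1 S2 S34 by (simp add: algebra_simps)
  also have "\<dots> = 2 * (of_nat ((a + 3) * (b + 2)) * Z p q - ?P p q)"
    unfolding skew[of q p] polarization_uminus by (simp add: algebra_simps)
  finally show ?thesis
    by (simp only: A_def I_def)
qed


section \<open>Polarizability of the minors\<close>

lemma finite_minor_indices: "finite (minor_indices m)"
  by (rule finite_subset[of _ "{1..m} \<times> {1..m}"]) (auto simp: minor_indices_def)

lemma minor2_in_polys_in: "j \<in> minor_indices m \<Longrightarrow> minor2 j \<in> polys_in (entry_indices m)"
  by (auto simp: minor_indices_def minor2_eq_det2 det2_def entry_indices_def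
      intro!: polys_in_diff polys_in_mult polys_in_var)

lemma is_submodule_polar_syzygies_minor2:
  "is_submodule (entry_indices m) (minor_indices m) (polar_syzygies (entry_indices m) (minor_indices m) minor2)"
  by (intro is_submodule_polar_syzygies polar_generators_subset_free_module minor2_in_polys_in)

text \<open>
  The homotopy formula shows \<open>(a + 3)(b + 2) Z \<in> \<D>\<close> modulo \<open>y\<partial>/\<partial>x (x\<partial>/\<partial>y Z)\<close>, and the
  derivation \<open>y\<partial>/\<partial>x\<close> maps \<open>\<D>\<close> into itself.  The numerical factor is invertible in characteristic zero.
\<close>

lemma upper_part_mem_if_polarization:
  fixes Z :: "nat \<Rightarrow> nat \<Rightarrow> (nat \<times> nat, 'k::field_char_0) mpoly"
  assumes Z: "null_matrix m Z" and bihom: "\<And>i j. bihomogeneous m (a, b) (Z i j)"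
    and IH: "upper_part m (\<lambda>i j. polarization m 2 1 (Z i j)) \<in>
      polar_syzygies (entry_indices m) (minor_indices m) minor2"
  shows "upper_part m Z \<in> polar_syzygies (entry_indices m) (minor_indices m) minor2"
proof -
  let ?V = "entry_indices m" and ?J = "minor_indices m" and ?I = "{1..m}"
  let ?M = "polar_syzygies ?V ?J (minor2 :: _ \<Rightarrow> (nat \<times> nat, 'k) mpoly)"
  note M = is_submodule_polar_syzygies_minor2[of m, where 'a = 'k]
  have scale: "(\<lambda>j. r * z j) \<in> ?M" if "r \<in> polys_in ?V" "z \<in> ?M" for r z
    using M that unfolding is_submodule_def by blast
  have add: "(\<lambda>j. z j + w j) \<in> ?M" if "z \<in> ?M" "w \<in> ?M" for z w
    using M that unfolding is_submodule_def by blast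
  define W where "W = (\<lambda>pq. \<Sum>k\<in>?I. \<Sum>l\<in>?I. \<Sum>i\<in>?I. \<Sum>j\<in>?I.
    partial (1, k) (partial (2, l) (Z i j)) * subst minor2 (partial pq (plucker_relation k l i j)))"
  have "(\<lambda>pq. partial (1, k) (partial (2, l) (Z i j)) * subst minor2 (partial pq (plucker_relation k l i j))) \<in> ?M"
    if "k \<in> ?I" "l \<in> ?I" "i \<in> ?I" "j \<in> ?I" for k l i j
  proof (rule scale)
    show "partial (1, k) (partial (2, l) (Z i j)) \<in> polys_in ?V"
      using null_matrix_in_polys_in[OF Z] by (intro partial_in_polys_in)
    show "(\<lambda>pq. subst minor2 (partial pq (plucker_relation k l i j))) \<in> ?M"
      unfolding polar_syzygies_def using plucker_relation_in_relation_ideal[OF that]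
      by (auto intro!: hull_inc)
  qed
  then have W: "W \<in> ?M"
    unfolding W_def by (intro is_submodule_sum[OF M]) auto
  define Q where "Q = (\<lambda>j. polarization m 1 2 (upper_part m (\<lambda>i j. polarization m 2 1 (Z i j)) j))"
  have Q: "Q \<in> ?M"
    unfolding Q_def
    by (rule derivation_preserves_polar_syzygies[OF finite_minor_indices minor2_in_polys_in
          derivation_polarization polarization_in_polys_in polarization_minor2 IH]) simp_all
  have two: "(const (2::'k) :: (nat \<times> nat, 'k) mpoly) = 2"
    by (simp add: const_def)
  define c :: 'k where "c = of_nat (2 * ((a + 3) * (b + 2)))"
  have "(\<lambda>j. const (inverse c) * (W j + const 2 * Q j)) \<in> ?M"
    by (intro scale add W Q) auto
  moreover have "upper_part m Z = (\<lambda>j. const (inverse c) * (W j + const 2 * Q j))"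
  proof
    fix j show "upper_part m Z j = const (inverse c) * (W j + const 2 * Q j)"
    proof (cases "j \<in> ?J")
      case True
      obtain p q where j: "j = (p, q)" by (cases j)
      have "W j + const 2 * Q j = of_nat (2 * ((a + 3) * (b + 2))) * Z p q"
        using homotopy_formula[OF Z bihom, of p q] True
        by (simp add: j W_def Q_def upper_part_def two algebra_simps)
      then have "const (inverse c) * (W j + const 2 * Q j) = const (inverse c * c) * Z p q"
        unfolding c_def const_mult const_of_nat by (simp only: mult.assoc)
      moreover have "c \<noteq> 0"
        unfolding c_def of_nat_eq_0_iff by simp
      ultimately show ?thesis
        using True by (simp add: j upper_part_def const_one)
    next
      case False
      then have "W j = 0" "Q j = 0"
        using W Q M unfolding is_submodule_def free_module_def by blast+
      with False show ?thesis
        by (auto simp: upper_part_def split: prod.split)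
    qed
  qed
  ultimately show ?thesis by simp
qed

text \<open>
  \<open>x\<partial>/\<partial>y\<close> lowers the degree in \<open>y\<close> by one and annihilates everything of degree zero in \<open>y\<close>, so the previous
  lemma applies inductively.
\<close>

lemma upper_part_mem_if_bihomogeneous:
  fixes Z :: "nat \<Rightarrow> nat \<Rightarrow> (nat \<times> nat, 'k::field_char_0) mpoly"
  assumes "null_matrix m Z" "\<And>i j. bihomogeneous m (a, b) (Z i j)"
  shows "upper_part m Z \<in> polar_syzygies (entry_indices m) (minor_indices m) minor2"
  using assms
proof (induction b arbitrary: a Z)
  case 0
  have "polarization m 2 1 (Z i j) = 0" for i j
  proof -
    have "polarization m 2 2 (Z i j) = 0"
      using 0(2)[of i j] by (simp add: bihomogeneous_def)
    then show ?thesis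
      using partial_eq_zero_if_degree_zero[of m 2 "Z i j"] by (simp add: polarization_def)
  qed
  then have "upper_part m (\<lambda>i j. polarization m 2 1 (Z i j)) = (\<lambda>_. 0)"
    by (auto simp: upper_part_def)
  then show ?case
    using is_submodule_polar_syzygies_minor2[of m, where 'a = 'k]
    by (intro upper_part_mem_if_polarization[OF 0]) (simp add: is_submodule_def)
next
  case (Suc b)
  have "bihomogeneous m (Suc a, b) (polarization m 2 1 (Z i j))" for i j
    using Suc.prems(2)[of i j] polarization_commutator[of m 1 1 2 1 "Z i j"]
      polarization_commutator[of m 2 2 2 1 "Z i j"]
    by (simp add: bihomogeneous_def polarization_of_nat_mult polarization_add algebra_simps)
  moreover have "null_matrix m (\<lambda>i j. polarization m 2 1 (Z i j))"
    using Suc.prems(1) by (intro null_matrix_polarization) auto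
  ultimately show ?case
    by (intro upper_part_mem_if_polarization[OF Suc.prems] Suc.IH)
qed

theorem proposition6p1:
  fixes m :: nat
  assumes "m \<ge> 3"
  shows "polarizable (entry_indices m) (minor_indices m)
           (minor2 :: nat \<times> nat \<Rightarrow> (nat \<times> nat, 'k::field_char_0) mpoly)"
  unfolding polarizable_def
proof (rule antisym)
  let ?V = "entry_indices m" and ?J = "minor_indices m"
  let ?f = "minor2 :: nat \<times> nat \<Rightarrow> (nat \<times> nat, 'k) mpoly"
  show "polar_syzygies ?V ?J ?f \<subseteq> differential_syzygies ?V ?J ?f"
    by (intro polar_syzygies_subset_differential_syzygies finite_minor_indices minor2_in_polys_in)
  show "differential_syzygies ?V ?J ?f \<subseteq> polar_syzygies ?V ?J ?f"
  proof
    fix z assume z: "z \<in> differential_syzygies ?V ?J ?f"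
    define Z where "Z = (\<lambda>i j. z (i, j) - z (j, i))"
    have Z: "null_matrix m Z" "upper_part m Z = z"
      using differential_syzygy_null_matrix[OF z] by (simp_all add: Z_def)
    define B where "B = (\<Union>j\<in>?J. bidegree m ` Poly_Mapping.keys (z j))"
    have "finite B"
      by (auto simp: B_def finite_minor_indices)
    have "upper_part m (\<lambda>i j. component m d (Z i j)) \<in> polar_syzygies ?V ?J ?f" for d
      by (cases d) (auto intro!: upper_part_mem_if_bihomogeneous null_matrix_component
          bihomogeneous_component Z(1))
    then have "(\<lambda>j. \<Sum>d\<in>B. upper_part m (\<lambda>i j. component m d (Z i j)) j) \<in> polar_syzygies ?V ?J ?f"
      by (rule is_submodule_sum[OF is_submodule_polar_syzygies_minor2])
    moreover have "(\<Sum>d\<in>B. upper_part m (\<lambda>i j. component m d (Z i j)) j) = z j" for j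
    proof (cases "j \<in> ?J")
      case True
      obtain p q where j: "j = (p, q)" by (cases j)
      have "Z p q = z j"
        using fun_cong[OF Z(2), of j] True by (simp add: j upper_part_def)
      then have "(\<Sum>d\<in>B. upper_part m (\<lambda>i j. component m d (Z i j)) j) = (\<Sum>d\<in>B. component m d (z j))"
        using True by (simp add: j upper_part_def)
      also have "\<dots> = z j"
        using True by (intro sum_components \<open>finite B\<close>) (auto simp: B_def)
      finally show ?thesis .
    next
      case False
      then show ?thesis
        using fun_cong[OF Z(2), of j] by (auto simp: upper_part_def split: prod.splits)
    qed
    ultimately show "z \<in> polar_syzygies ?V ?J ?f"
      by simp
  qed
qed

end
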